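(* Let $B$ be a non-trivial Boolean algebra and let $\mathcal C$ be a non-empty family of ultracontacts on $B$. Then the meet $\bigwedge\mathcal C$ of $\mathcal C$ in the lattice $\mathrm{UC}(B)$ is \[\Big\{F\in 2^B_+ : \text{for all } n\ge 1 \text{ and all } G_1,\dots,G_n\in 2^B_+,\ \big(F\preceq G_1+\dots+G_n \Rightarrow G_i\in\textstyle\bigcap\mathcal C \text{ for some } i\le n\big)\Big\}.\]
   Context: Let $B$ be a non-trivial Boolean algebra with order $\le$ and join $+$; $2^B_+$ is the set of non-empty subsets of $B$. For $F_1,\dots,F_n\subseteq B$ put $F_1+\dots+F_n=\{f_1+\dots+f_n: f_i\in F_i\}$, and write $F\preceq G$ iff for every $g\in G$ there is $f\in F$ with $f\le g$. An ultracontact on $B$ is a family $\mathscr K\subseteq 2^B$ such that for all $F,G\subseteq B$: (K0) $\emptyset\notin\mathscr K$; (K1) if $0\in F$ then $F\notin\mathscr K$; (K2) if $x\neq 0$ then $\{x\}\in\mathscr K$; (K3) if $F\preceq G$, $G\neq\emptyset$ and $F\in\mathscr K$, then $G\in\mathscr K$; (K4) if $F+G\in\mathscr K$ then $F\in\mathscr K$ or $G\in\mathscr K$. $\mathrm{UC}(B)$ is the complete lattice of ultracontacts on $B$ ordered by inclusion. *)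

theory Defs
  imports "HOL-Algebra.Lattice"
begin

(* HOL-Algebra reuses the names of the operations of the class boolean_algebra. *)
hide_const (open) Lattice.sup Lattice.inf Order.top

definition set_join :: "'a::boolean_algebra set \<Rightarrow> 'a set \<Rightarrow> 'a set" where
  "set_join F G = {sup f g | f g. f \<in> F \<and> g \<in> G}"

(* G 1 + ... + G n, for n >= 1; Sup_fin is specified only on non-empty finite sets. *)
definition set_joins :: "nat \<Rightarrow> (nat \<Rightarrow> 'a::boolean_algebra set) \<Rightarrow> 'a set" where
  "set_joins n G = {\<Squnion>\<^sub>f\<^sub>i\<^sub>n (g ` {1..n}) | g. \<forall>i\<in>{1..n}. g i \<in> G i}"

lemma set_joins_1: "set_joins 1 G = G 1"
proof -
  have "\<exists>g. x = g 1 \<and> g 1 \<in> G 1" if "x \<in> G 1" for x :: 'a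
    using that by (intro exI[of _ "\<lambda>_. x"]) simp
  then show ?thesis by (auto simp: set_joins_def)
qed

lemma set_joins_Suc:
  assumes "n \<ge> 1"
  shows "set_joins (Suc n) G = set_join (set_joins n G) (G (Suc n))"
proof -
  have *: "\<Squnion>\<^sub>f\<^sub>i\<^sub>n (g ` {1..Suc n}) = sup (\<Squnion>\<^sub>f\<^sub>i\<^sub>n (g ` {1..n})) (g (Suc n))" for g :: "nat \<Rightarrow> 'a"
    using assms by (simp add: atLeastAtMostSuc_conv Sup_fin.insert sup.commute)
  show ?thesis
  proof (intro equalityI subsetI)
    fix x assume "x \<in> set_joins (Suc n) G"
    then obtain g where "x = \<Squnion>\<^sub>f\<^sub>i\<^sub>n (g ` {1..Suc n})" "\<forall>i\<in>{1..Suc n}. g i \<in> G i"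
      by (auto simp: set_joins_def)
    then show "x \<in> set_join (set_joins n G) (G (Suc n))"
      unfolding * set_join_def set_joins_def by fastforce
  next
    fix x assume "x \<in> set_join (set_joins n G) (G (Suc n))"
    then obtain g b where g: "x = sup (\<Squnion>\<^sub>f\<^sub>i\<^sub>n (g ` {1..n})) b" "\<forall>i\<in>{1..n}. g i \<in> G i" "b \<in> G (Suc n)"
      by (auto simp: set_join_def set_joins_def)
    have "g(Suc n := b) ` {1..n} = g ` {1..n}" by (intro image_cong) auto
    then have "x = \<Squnion>\<^sub>f\<^sub>i\<^sub>n (g(Suc n := b) ` {1..Suc n})" unfolding * using g(1) by simp
    moreover have "\<forall>i\<in>{1..Suc n}. (g(Suc n := b)) i \<in> G i" using g by auto
    ultimately show "x \<in> set_joins (Suc n) G" unfolding set_joins_def by blast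
  qed
qed

definition set_le :: "'a::boolean_algebra set \<Rightarrow> 'a set \<Rightarrow> bool"  (infix \<open>\<preceq>\<close> 50) where
  "F \<preceq> G \<longleftrightarrow> (\<forall>g\<in>G. \<exists>f\<in>F. f \<le> g)"

definition ultracontact :: "'a::boolean_algebra set set \<Rightarrow> bool" where
  "ultracontact K \<longleftrightarrow>
     {} \<notin> K \<and>
     (\<forall>F. bot \<in> F \<longrightarrow> F \<notin> K) \<and>
     (\<forall>x. x \<noteq> bot \<longrightarrow> {x} \<in> K) \<and>
     (\<forall>F G. F \<preceq> G \<and> G \<noteq> {} \<and> F \<in> K \<longrightarrow> G \<in> K) \<and>
     (\<forall>F G. set_join F G \<in> K \<longrightarrow> F \<in> K \<or> G \<in> K)"

definition UC :: "'a::boolean_algebra set set gorder" where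
  "UC = \<lparr>carrier = {K. ultracontact K}, eq = (=), le = (\<subseteq>)\<rparr>"

end

theory Submission
  imports Defs
begin

text \<open>
  The family \<open>join_core (\<Inter>C)\<close> satisfies (K4) because witnesses against \<open>F\<close> and against \<open>H\<close>,
  concatenated, are a witness against \<open>F + H\<close>, and it contains every ultracontact below \<open>\<Inter>C\<close> by
  iterating (K4). Only (K2) is delicate, since the index \<open>i\<close> must serve all members of \<open>C\<close> at once: a
  set with a non-zero lower bound lies in every ultracontact, whereas if no \<open>G i\<close> has a
  non-zero lower bound, then neither has \<open>G 1 + \<dots> + G n\<close>, by distributivity.
\<close>

lemma set_le_refl: "F \<preceq> F"
  by (auto simp: set_le_def)

lemma set_le_trans: "F \<preceq> G \<Longrightarrow> G \<preceq> H \<Longrightarrow> F \<preceq> H"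
  unfolding set_le_def by (meson order_trans)

lemma set_join_mono:
  assumes "F \<preceq> F'" "G \<preceq> G'"
  shows "set_join F G \<preceq> set_join F' G'"
  unfolding set_le_def
proof
  fix x assume "x \<in> set_join F' G'"
  then obtain f' g' where x: "x = sup f' g'" "f' \<in> F'" "g' \<in> G'"
    by (auto simp: set_join_def)
  then obtain f g where fg: "f \<in> F" "f \<le> f'" "g \<in> G" "g \<le> g'"
    using assms unfolding set_le_def by blast
  then have "sup f g \<in> set_join F G" by (auto simp: set_join_def)
  moreover have "sup f g \<le> x" unfolding x(1) using fg by (intro sup_mono)
  ultimately show "\<exists>y\<in>set_join F G. y \<le> x" ..
qed

lemma set_join_assoc: "set_join (set_join F G) H = set_join F (set_join G H)"
proof (intro equalityI subsetI)
  fix x assume "x \<in> set_join (set_join F G) H"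
  then obtain f g h where "x = sup f (sup g h)" "f \<in> F" "g \<in> G" "h \<in> H"
    by (auto simp: set_join_def sup_assoc)
  then show "x \<in> set_join F (set_join G H)"
    unfolding set_join_def by blast
next
  fix x assume "x \<in> set_join F (set_join G H)"
  then obtain f g h where "x = sup (sup f g) h" "f \<in> F" "g \<in> G" "h \<in> H"
    by (auto simp: set_join_def sup_assoc)
  then show "x \<in> set_join (set_join F G) H"
    unfolding set_join_def by blast
qed

lemma set_join_eq_empty_iff: "set_join F G = {} \<longleftrightarrow> F = {} \<or> G = {}"
  by (auto simp: set_join_def)

text \<open>(K3) only passes to non-empty sets, so this is what makes it applicable to a sum of
  non-empty sets.\<close>

lemma set_joins_nonempty:
  assumes "\<forall>i\<in>{1..n}. G i \<noteq> {}"
  shows "set_joins n G \<noteq> {}"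
proof -
  have "\<forall>i\<in>{1..n}. (SOME g. g \<in> G i) \<in> G i"
    using assms some_in_eq by blast
  then have "\<Squnion>\<^sub>f\<^sub>i\<^sub>n ((\<lambda>i. SOME g. g \<in> G i) ` {1..n}) \<in> set_joins n G"
    unfolding set_joins_def by blast
  then show ?thesis by blast
qed

lemma set_joins_cong:
  assumes "\<And>i. i \<in> {1..n} \<Longrightarrow> G i = H i"
  shows "set_joins n G = set_joins n H"
  using assms by (simp add: set_joins_def)

text \<open>Serves (K4), where two families are concatenated; the shift \<open>i - n\<close> lets
  \<open>H\<close> start again at index 1. Induction on \<open>m\<close> moves the last summand
  across by associativity.\<close>

lemma set_joins_append:
  assumes "n \<ge> 1" "m \<ge> 1"
  shows "set_joins (n + m) (\<lambda>i. if i \<le> n then G i else H (i - n))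
           = set_join (set_joins n G) (set_joins m H)"
  using assms(2)
proof (induction m rule: dec_induct)
  case base
  have "set_joins n (\<lambda>i. if i \<le> n then G i else H (i - n)) = set_joins n G"
    by (rule set_joins_cong) simp
  then show ?case
    using set_joins_Suc[OF assms(1), of "\<lambda>i. if i \<le> n then G i else H (i - n)"]
    by (simp add: set_joins_1[simplified])
next
  case (step m)
  let ?E = "\<lambda>i. if i \<le> n then G i else H (i - n)"
  have "set_joins (n + Suc m) ?E = set_join (set_joins (n + m) ?E) (H (Suc m))"
    using assms(1) set_joins_Suc[of "n + m" ?E] by (simp add: Suc_diff_le)
  also have "\<dots> = set_join (set_joins n G) (set_joins (Suc m) H)"
    unfolding step.IH set_joins_Suc[OF step.hyps(1)] set_join_assoc ..
  finally show ?case .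
qed

text \<open>Split off the last summand: a lower bound of all \<open>sup s g\<close> turns out to be
  a lower bound of the shorter sum, where the induction hypothesis makes it
  \<open>bot\<close>.\<close>

lemma set_joins_lower_bound:
  assumes "n \<ge> 1"
    and "\<And>i x. i \<in> {1..n} \<Longrightarrow> \<forall>g\<in>G i. x \<le> g \<Longrightarrow> x = bot"
    and "\<forall>s\<in>set_joins n G. x \<le> s"
  shows "x = bot"
  using assms
proof (induction n arbitrary: x rule: dec_induct)
  case base
  then show ?case by (auto simp: set_joins_1[simplified])
next
  case (step n)
  \<comment> \<open>\<open>x - s\<close> is a lower bound of \<open>G (Suc n)\<close>, hence \<open>x \<le> s\<close>.\<close>
  have "x \<le> s" if s: "s \<in> set_joins n G" for s
  proof -
    have "\<forall>g\<in>G (Suc n). x \<le> sup s g"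
      using step.prems(2) s set_joins_Suc[OF step.hyps(1), of G]
      by (auto simp: set_join_def)
    \<comment> \<open>Distributivity enters here, as the shunting rule:
      \<open>x \<le> sup s g\<close> iff \<open>inf x (- s) \<le> g\<close>.\<close>
    then have "\<forall>g\<in>G (Suc n). inf x (- s) \<le> g"
      by (metis double_compl shunt1)
    then have "inf x (- s) = bot"
      using step.prems(1)[of "Suc n"] by simp
    then show "x \<le> s"
      by (metis double_compl inf_shunt)
  qed
  moreover have "y = bot" if "i \<in> {1..n}" "\<forall>g\<in>G i. y \<le> g" for i y
    using step.prems(1)[of i y] that by simp
  ultimately show ?case
    using step.IH by blast
qed

lemma
  assumes "ultracontact K"
  shows ultracontact_empty: "{} \<notin> K"
    and ultracontact_bot: "bot \<in> F \<Longrightarrow> F \<notin> K"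
    and ultracontact_singleton: "x \<noteq> bot \<Longrightarrow> {x} \<in> K"
    and ultracontact_mono: "F \<in> K \<Longrightarrow> F \<preceq> G \<Longrightarrow> G \<noteq> {} \<Longrightarrow> G \<in> K"
    and ultracontact_join: "set_join F G \<in> K \<Longrightarrow> F \<in> K \<or> G \<in> K"
  using assms unfolding ultracontact_def by blast+

lemma ultracontact_joins:
  assumes "ultracontact K" "n \<ge> 1" "set_joins n G \<in> K"
  shows "\<exists>i\<in>{1..n}. G i \<in> K"
  using assms(2,3)
proof (induction n rule: dec_induct)
  case base
  then show ?case by (simp add: set_joins_1[simplified])
next
  case (step n)
  then have "set_joins n G \<in> K \<or> G (Suc n) \<in> K"
    using ultracontact_join[OF assms(1)] by (simp add: set_joins_Suc)
  then show ?case
  proof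
    assume "set_joins n G \<in> K"
    then obtain i where "i \<in> {1..n}" "G i \<in> K" using step.IH by blast
    then show ?thesis by (intro bexI[of _ i]) auto
  qed auto
qed

text \<open>Stated for arbitrary \<open>X\<close>, because (K3) and (K4) hold for every
  \<open>X\<close>; that \<open>X\<close> is an intersection of ultracontacts enters only for (K1)
  and (K2).\<close>

definition join_core :: "'a::boolean_algebra set set \<Rightarrow> 'a set set" where
  "join_core X = {F. F \<noteq> {} \<and>
      (\<forall>n\<ge>1. \<forall>G::nat \<Rightarrow> 'a set. (\<forall>i\<in>{1..n}. G i \<noteq> {}) \<longrightarrow>
         F \<preceq> set_joins n G \<longrightarrow> (\<exists>i\<in>{1..n}. G i \<in> X))}"

lemma join_coreD:
  assumes "F \<in> join_core X" "n \<ge> 1" "\<forall>i\<in>{1..n}. G i \<noteq> {}" "F \<preceq> set_joins n G"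
  shows "\<exists>i\<in>{1..n}. G i \<in> X"
  using assms by (simp add: join_core_def)

text \<open>Test membership on the one-term sum with \<open>G 1 = F\<close>.\<close>

lemma join_core_subset: "join_core X \<subseteq> X"
proof
  fix F assume F: "F \<in> join_core X"
  then have "F \<noteq> {}" by (simp add: join_core_def)
  moreover have "F \<preceq> set_joins 1 (\<lambda>_. F)"
    unfolding set_joins_1 by (rule set_le_refl)
  ultimately show "F \<in> X"
    using join_coreD[OF F, of 1 "\<lambda>_. F"] by simp
qed

text \<open>If \<open>F \<in> L\<close> and \<open>F \<preceq> set_joins n G\<close>, then (K3) puts
  the sum into \<open>L\<close>, and iterated (K4) puts some \<open>G i\<close> into
  \<open>L\<close>, hence into \<open>X\<close>.\<close>

lemma ultracontact_subset_join_core: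
  assumes "ultracontact L" "L \<subseteq> X"
  shows "L \<subseteq> join_core X"
proof
  fix F assume F: "F \<in> L"
  have "\<exists>i\<in>{1..n}. G i \<in> X"
    if "n \<ge> 1" "\<forall>i\<in>{1..n}. G i \<noteq> {}" "F \<preceq> set_joins n G" for n and G :: "nat \<Rightarrow> 'a set"
    using ultracontact_joins[OF assms(1) that(1)]
      ultracontact_mono[OF assms(1) F that(3) set_joins_nonempty[OF that(2)]] assms(2)
    by blast
  then show "F \<in> join_core X"
    using F ultracontact_empty[OF assms(1)] unfolding join_core_def by blast
qed

text \<open>By transitivity of \<open>\<preceq>\<close>, a family that witnesses against
  \<open>G\<close> also witnesses against \<open>F\<close>.\<close>

lemma join_core_mono:
  assumes "F \<in> join_core X" "F \<preceq> G" "G \<noteq> {}"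
  shows "G \<in> join_core X"
proof -
  have "\<exists>i\<in>{1..n}. H i \<in> X"
    if "n \<ge> 1" "\<forall>i\<in>{1..n}. H i \<noteq> {}" "G \<preceq> set_joins n H" for n and H :: "nat \<Rightarrow> 'a set"
    using join_coreD[OF assms(1) that(1,2) set_le_trans[OF assms(2) that(3)]] .
  then show ?thesis
    using assms(3) unfolding join_core_def by blast
qed

lemma join_core_join:
  assumes "set_join F H \<in> join_core X"
  shows "F \<in> join_core X \<or> H \<in> join_core X"
proof (rule ccontr)
  assume "\<not> ?thesis"
  \<comment> \<open>With emptiness excluded, non-membership can only come from a witnessing
    family.\<close>
  moreover have "F \<noteq> {}" "H \<noteq> {}"
    using assms by (auto simp: join_core_def set_join_eq_empty_iff)
  ultimately obtain n G m G' where
    G: "n \<ge> 1" "\<forall>i\<in>{1..n}. G i \<noteq> {}" "F \<preceq> set_joins n G" "\<forall>i\<in>{1..n}. G i \<notin> X" and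
    G': "m \<ge> 1" "\<forall>i\<in>{1..m}. G' i \<noteq> {}" "H \<preceq> set_joins m G'" "\<forall>i\<in>{1..m}. G' i \<notin> X"
    unfolding join_core_def by blast
  define E where "E = (\<lambda>i. if i \<le> n then G i else G' (i - n))"
  have E: "E i \<noteq> {} \<and> E i \<notin> X" if "i \<in> {1..n + m}" for i
  proof (cases "i \<le> n")
    case True
    then show ?thesis using that G by (simp add: E_def)
  next
    case False
    then have "i - n \<in> {1..m}" using that by auto
    then show ?thesis using False G' by (simp add: E_def)
  qed
  have "set_join F H \<preceq> set_joins (n + m) E"
    unfolding E_def set_joins_append[OF G(1) G'(1)] by (rule set_join_mono[OF G(3) G'(3)])
  moreover have "n + m \<ge> 1" using G(1) by simp
  ultimately show False
    using join_coreD[OF assms, of "n + m" E] E by blast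
qed

lemma ultracontact_join_core_Inter:
  assumes "\<forall>K\<in>C. ultracontact K" "C \<noteq> {}"
  shows "ultracontact (join_core (\<Inter>C))"
proof -
  \<comment> \<open>As \<open>C\<close> is non-empty, \<open>join_core (\<Inter>C)\<close> lies
    inside some ultracontact, and (K1) is inherited from it.\<close>
  have "F \<notin> join_core (\<Inter>C)" if "bot \<in> F" for F
    using join_core_subset assms ultracontact_bot[OF _ that] by blast
  moreover have "{x} \<in> join_core (\<Inter>C)" if x: "x \<noteq> bot" for x
  proof -
    have "\<exists>i\<in>{1..n}. G i \<in> \<Inter>C"
      if n: "n \<ge> 1" and G: "\<forall>i\<in>{1..n}. G i \<noteq> {}" and le: "{x} \<preceq> set_joins n G"
      for n and G :: "nat \<Rightarrow> 'a set"
    proof (rule ccontr)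
      assume none: "\<not> ?thesis"
      have "y = bot" if i: "i \<in> {1..n}" and y: "\<forall>g\<in>G i. y \<le> g" for i y
      proof (rule ccontr)
        assume "y \<noteq> bot"
        \<comment> \<open>The bound \<open>y\<close> does not depend on \<open>K\<close>, so (K2)
          and (K3) work for the same \<open>i\<close> in every member of \<open>C\<close>.\<close>
        have "G i \<in> K" if "K \<in> C" for K
        proof (rule ultracontact_mono)
          show K: "ultracontact K" using assms(1) that by blast
          show "{y} \<in> K" using ultracontact_singleton[OF K \<open>y \<noteq> bot\<close>] .
          show "{y} \<preceq> G i" using y by (simp add: set_le_def)
          show "G i \<noteq> {}" using G i by blast
        qed
        then show False using none i by blast
      qed
      moreover have "\<forall>s\<in>set_joins n G. x \<le> s" using le by (simp add: set_le_def)
      ultimately show False using set_joins_lower_bound[OF n, of G x] x by blast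
    qed
    then show ?thesis unfolding join_core_def by blast
  qed
  moreover have "{} \<notin> join_core (\<Inter>C)" by (simp add: join_core_def)
  ultimately show ?thesis
    unfolding ultracontact_def
    using join_core_mono[of _ "\<Inter>C"] join_core_join[of _ _ "\<Inter>C"]
    by (intro conjI allI impI) auto
qed

lemma partial_order_UC: "partial_order UC"
  by unfold_locales (auto simp: UC_def)

theorem theorem4p8:
  fixes C :: "'a::boolean_algebra set set set"
  assumes "(bot::'a) \<noteq> top"
    and "C \<subseteq> carrier UC"
    and "C \<noteq> {}"
  defines "M \<equiv> {F::'a set. F \<noteq> {} \<and>
      (\<forall>n\<ge>1. \<forall>G::nat \<Rightarrow> 'a set. (\<forall>i\<in>{1..n}. G i \<noteq> {}) \<longrightarrow>
         F \<preceq> set_joins n G \<longrightarrow> (\<exists>i\<in>{1..n}. G i \<in> \<Inter>C))}"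
  shows "is_glb UC M C \<and> \<Sqinter>\<^bsub>UC\<^esub> C = M"
proof
  have M: "M = join_core (\<Inter>C)" by (simp add: M_def join_core_def)
  have C: "\<forall>K\<in>C. ultracontact K" using assms(2) by (auto simp: UC_def)
  show glb: "is_glb UC M C"
  proof (rule greatest_LowerI)
    fix L assume "L \<in> Lower UC C"
    then have "ultracontact L" "L \<subseteq> \<Inter>C"
      using C by (auto simp: Lower_def UC_def)
    then have "L \<subseteq> M"
      unfolding M by (rule ultracontact_subset_join_core)
    then show "L \<sqsubseteq>\<^bsub>UC\<^esub> M"
      by (simp add: UC_def)
  next
    fix K assume "K \<in> C"
    then have "M \<subseteq> K" using join_core_subset unfolding M by blast
    then show "M \<sqsubseteq>\<^bsub>UC\<^esub> K" by (simp add: UC_def)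
  next
    show "C \<subseteq> carrier UC" by (rule assms(2))
    show "M \<in> carrier UC"
      using ultracontact_join_core_Inter[OF C assms(3)] unfolding M UC_def by simp
  qed
  \<comment> \<open>The meet is a Hilbert choice among greatest lower bounds; antisymmetry makes
    such a bound unique and so identifies the chosen one with \<open>M\<close>.\<close>
  interpret partial_order "UC :: 'a set set gorder" by (rule partial_order_UC)
  show "\<Sqinter>\<^bsub>UC\<^esub> C = M"
    unfolding Lattice.inf_def
    by (rule some_equality[where P = "\<lambda>X. is_glb UC X C"], rule glb, rule greatest_unique[OF _ glb])
qed

end
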